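(* Let $N$ be a positive integer. Then, for almost all $\varphi\in\mathbb{C}^N$, the following equivalent conditions hold: (1) Every minor of $A_{\varphi}$ of order $N$ is nonzero. (2) The Gabor frame $(\varphi,(\mathbb{Z}/N\mathbb{Z})^2)$ is in general linear position. (3) The Gabor frame $(\varphi,(\mathbb{Z}/N\mathbb{Z})^2)$ is an equal norm tight frame that is maximally robust to erasures. (4) For all $f\in\mathbb{C}^N\setminus\{0\}$, we have $|\operatorname{supp}(V_{\varphi}f)|\geq N^2-N+1$. (5) For all $f\in\mathbb{C}^N\setminus\{0\}$, $V_{\varphi}f$, and therefore $f$, is completely determined by its values on a set $\Lambda$ with $|\Lambda|=N$. (6) $\mathcal{H}_{\Lambda}$ is identifiable by $\varphi$ if and only if $|\Lambda|=N$.
   Context: Let $N$ be a positive integer and $\omega=e^{2\pi i/N}$. "Almost all" is with respect to Lebesgue measure on $\mathbb{C}^N$. Define the linear operators $T,M:\mathbb{C}^N\to\mathbb{C}^N$ by $$T(x_0,x_1,\dots,x_{N-1})=(x_{N-1},x_0,\dots,x_{N-2}),\qquad M(x_0,x_1,\dots,x_{N-1})=(x_0,\omega x_1,\dots,\omega^{N-1}x_{N-1}),$$ and for $(\kappa,\lambda)\in(\mathbb{Z}/N\mathbb{Z})^2$ put $\pi(\kappa,\lambda)=M^{\lambda}T^{\kappa}$. Throughout, $\Lambda$ denotes a subset of $(\mathbb{Z}/N\mathbb{Z})^2$. For $\varphi\in\mathbb{C}^N$ and $\Lambda\subseteq(\mathbb{Z}/N\mathbb{Z})^2$, the Gabor frame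 $(\varphi,\Lambda)$ is the set of all vectors $\pi(\kappa,\lambda)\varphi$ with $(\kappa,\lambda)\in\Lambda$. It is in general linear position if $(\varphi,\Lambda')$ is a basis of $\mathbb{C}^N$ for every $\Lambda'\subseteq\Lambda$ with $|\Lambda'|=N$. A finite set $\{\varphi_k\}_{k\in K}$ of vectors in $\mathbb{C}^N$ is a frame for $\mathbb{C}^N$ if there are constants $0<c_1\le c_2$ with $c_1\|f\|_2^2\le\sum_{k\in K}|\langle f,\varphi_k\rangle|^2\le c_2\|f\|_2^2$ for all $f\in\mathbb{C}^N$, where $\langle\cdot,\cdot\rangle$ is the Hermitian inner product. It is tight if one can take $c_1=c_2$; a tight frame is an equal norm tight frame if $\|\varphi_k\|_2=C>0$ for all $k\in K$, for some constant $C$. The frame is maximally robust to erasures if any subset of at most $N$ vectors of $\{\varphi_k\}_{k\in K}$ is linearly independent. The short-time Fourier transform $V_{\varphi}:\mathbb{C}^N\to\mathbb{C}^{N^2}$ with respect to the window $\varphi\in\mathbb{C}^N$ is given by $V_{\varphi}f(\kappa,\lambda)=\langle f,\pi(\kappa,\lambda)\varphi\rangle$ for all $f\in\mathbb{C}^N$, $\kappa,\lambda\in\mathbb{Z}/N\mathbb{Z}$. $A_{\varphi}$ denotes the matrix representation of $V_{\varphi}$ under some ordering of $(\mathbb{Z}/N\mathbb{Z})^2$, and $\operatorname{supp}(V_\varphi f)$ is the set of $(\kappa,\lambda)$ with $V_\varphi f(\kappa,\lambda)\ne0$. A linear space $\mathcal{H}$ of operators mapping $\mathbb{C}^N$ to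 $\mathbb{C}^{m}$ is identifiable by $\varphi\in\mathbb{C}^N$ (with identifier $\varphi$) if the map $H\mapsto H\varphi$ from $\mathcal{H}$ to $\mathbb{C}^{m}$ is injective. $\mathcal{H}_{\Lambda}$ denotes the complex linear space of operators spanned by $\pi(\kappa,\lambda)$, $(\kappa,\lambda)\in\Lambda$.
   Formalization: Condition (6) is stated with |Λ| ≤ N in place of |Λ| = N, because with equality it fails for every φ (Λ = ∅ gives the identifiable zero space); (5) is read as holding for every Λ with |Λ| = N, and Gabor frames as indexed families. *)

theory Defs
  imports "HOL-Analysis.Analysis" "Berlekamp_Zassenhaus.Finite_Field"
begin

text \<open>
  The type variable \<open>'n\<close> only carries the dimension \<open>N = CARD('n)\<close>, an arbitrary positive
  integer. The coordinates of \<open>\<complex>\<^sup>N\<close> are indexed by \<open>'n mod_ring\<close>, the integers modulo \<open>N\<close>.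
\<close>

type_synonym 'n cvec = "complex ^ 'n mod_ring"
type_synonym 'n tf = "'n mod_ring \<times> 'n mod_ring"

section \<open>Time-frequency shifts\<close>

text \<open>The representative in \<open>{0..<N}\<close>.\<close>

definition rep :: "'n::finite mod_ring \<Rightarrow> nat" where
  "rep k = nat (to_int_mod_ring k)"

text \<open>The unit of \<open>'n mod_ring\<close> is written \<open>of_int_mod_ring 1\<close>, since the library provides the
  constant \<open>1\<close> only for \<open>N > 1\<close>.\<close>

definition shift_op :: "'n::finite cvec \<Rightarrow> 'n cvec" where
  "shift_op x = (\<chi> k. x $ (k - of_int_mod_ring 1))"

definition modulation_op :: "'n::finite cvec \<Rightarrow> 'n cvec" where
  "modulation_op x = (\<chi> k. exp (2 * of_real pi * \<i> / of_nat CARD('n)) ^ rep k * x $ k)"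

definition tf_shift :: "'n::finite tf \<Rightarrow> 'n cvec \<Rightarrow> 'n cvec" where
  "tf_shift p = (modulation_op ^^ rep (snd p)) \<circ> (shift_op ^^ rep (fst p))"

section \<open>Families of vectors and frames\<close>

text \<open>
  Systems of vectors are indexed families, so repeated vectors count with multiplicity (hence the
  conjunct \<open>inj_on\<close>); linear independence and span are over the complex numbers, as \<open>vec\<close> refers
  to scalar multiplication \<open>*s\<close>.
\<close>

definition lin_indep_family :: "('k \<Rightarrow> complex ^ 'd::finite) \<Rightarrow> 'k set \<Rightarrow> bool" where
  "lin_indep_family v K \<longleftrightarrow> inj_on v K \<and> vec.independent (v ` K)"

definition basis_family :: "('k \<Rightarrow> complex ^ 'd::finite) \<Rightarrow> 'k set \<Rightarrow> bool" where
  "basis_family v K \<longleftrightarrow> lin_indep_family v K \<and> vec.span (v ` K) = UNIV"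

text \<open>The library's \<open>inner\<close> on complex vectors is only the real part of this form.\<close>

definition hinner :: "complex ^ 'd::finite \<Rightarrow> complex ^ 'd \<Rightarrow> complex" where
  "hinner f g = (\<Sum>i\<in>UNIV. f $ i * cnj (g $ i))"

definition frame_bounds ::
    "('k \<Rightarrow> complex ^ 'd::finite) \<Rightarrow> 'k set \<Rightarrow> real \<Rightarrow> real \<Rightarrow> bool" where
  "frame_bounds v K c1 c2 \<longleftrightarrow>
     (\<forall>f. c1 * (norm f)\<^sup>2 \<le> (\<Sum>k\<in>K. (cmod (hinner f (v k)))\<^sup>2) \<and>
          (\<Sum>k\<in>K. (cmod (hinner f (v k)))\<^sup>2) \<le> c2 * (norm f)\<^sup>2)"

definition is_frame :: "('k \<Rightarrow> complex ^ 'd::finite) \<Rightarrow> 'k set \<Rightarrow> bool" where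
  "is_frame v K \<longleftrightarrow> finite K \<and> (\<exists>c1 c2. 0 < c1 \<and> c1 \<le> c2 \<and> frame_bounds v K c1 c2)"

definition tight_frame :: "('k \<Rightarrow> complex ^ 'd::finite) \<Rightarrow> 'k set \<Rightarrow> bool" where
  "tight_frame v K \<longleftrightarrow> is_frame v K \<and> (\<exists>c>0. frame_bounds v K c c)"

definition equal_norm_tight_frame :: "('k \<Rightarrow> complex ^ 'd::finite) \<Rightarrow> 'k set \<Rightarrow> bool" where
  "equal_norm_tight_frame v K \<longleftrightarrow> tight_frame v K \<and> (\<exists>C>0. \<forall>k\<in>K. norm (v k) = C)"

definition maximally_robust :: "('k \<Rightarrow> complex ^ 'd::finite) \<Rightarrow> 'k set \<Rightarrow> bool" where
  "maximally_robust v K \<longleftrightarrow>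
     (\<forall>J\<subseteq>K. finite J \<and> card J \<le> CARD('d) \<longrightarrow> lin_indep_family v J)"

section \<open>Gabor frames and the short-time Fourier transform\<close>

definition gabor :: "'n::finite cvec \<Rightarrow> 'n tf \<Rightarrow> 'n cvec" where
  "gabor \<phi> p = tf_shift p \<phi>"

definition general_linear_position :: "'n::finite cvec \<Rightarrow> 'n tf set \<Rightarrow> bool" where
  "general_linear_position \<phi> \<Lambda> \<longleftrightarrow>
     (\<forall>\<Lambda>'\<subseteq>\<Lambda>. card \<Lambda>' = CARD('n) \<longrightarrow> basis_family (gabor \<phi>) \<Lambda>')"

definition stft :: "'n::finite cvec \<Rightarrow> 'n cvec \<Rightarrow> complex ^ 'n tf" where
  "stft \<phi> f = (\<chi> p. hinner f (tf_shift p \<phi>))"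

definition stft_supp :: "'n::finite cvec \<Rightarrow> 'n cvec \<Rightarrow> 'n tf set" where
  "stft_supp \<phi> f = {p. stft \<phi> f $ p \<noteq> 0}"

text \<open>Rows are indexed directly by the pairs \<open>(\<kappa>, \<lambda>)\<close>; a choice of ordering only affects the
  signs of minors.\<close>

definition stft_matrix :: "'n::finite cvec \<Rightarrow> complex ^ 'n mod_ring ^ 'n tf" where
  "stft_matrix \<phi> = matrix (stft \<phi>)"

text \<open>The minors of order \<open>CARD('m)\<close> of a matrix are obtained by selecting distinct rows \<open>r\<close> and
  distinct columns \<open>c\<close>.\<close>

definition minor ::
    "complex ^ 'b::finite ^ 'a::finite \<Rightarrow> ('m::finite \<Rightarrow> 'a) \<Rightarrow> ('m \<Rightarrow> 'b) \<Rightarrow> complex" where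
  "minor A r c = det (\<chi> i j. A $ r i $ c j)"

section \<open>Identifiability\<close>

definition operator_span :: "'n::finite tf set \<Rightarrow> ('n cvec \<Rightarrow> 'n cvec) set" where
  "operator_span \<Lambda> = {(\<lambda>x. \<Sum>p\<in>\<Lambda>. a p *s tf_shift p x) | a. True}"

definition identifiable ::
    "(complex ^ 'd::finite \<Rightarrow> complex ^ 'm::finite) set \<Rightarrow> complex ^ 'd \<Rightarrow> bool" where
  "identifiable \<H> \<phi> \<longleftrightarrow> inj_on (\<lambda>H. H \<phi>) \<H>"

section \<open>The conditions on the window\<close>

definition all_minors_nonzero :: "'n::finite cvec \<Rightarrow> bool" where
  "all_minors_nonzero \<phi> \<longleftrightarrow>
     (\<forall>(r :: 'n mod_ring \<Rightarrow> 'n tf) (c :: 'n mod_ring \<Rightarrow> 'n mod_ring).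
        inj r \<longrightarrow> inj c \<longrightarrow> minor (stft_matrix \<phi>) r c \<noteq> 0)"

definition full_gabor_glp :: "'n::finite cvec \<Rightarrow> bool" where
  "full_gabor_glp \<phi> \<longleftrightarrow> general_linear_position \<phi> UNIV"

definition full_gabor_robust_entf :: "'n::finite cvec \<Rightarrow> bool" where
  "full_gabor_robust_entf \<phi> \<longleftrightarrow>
     equal_norm_tight_frame (gabor \<phi>) UNIV \<and> maximally_robust (gabor \<phi>) UNIV"

definition large_stft_supp :: "'n::finite cvec \<Rightarrow> bool" where
  "large_stft_supp \<phi> \<longleftrightarrow>
     (\<forall>f. f \<noteq> 0 \<longrightarrow> card (stft_supp \<phi> f) \<ge> CARD('n)\<^sup>2 - CARD('n) + 1)"

text \<open>Both \<open>stft \<phi> f\<close> and \<open>f\<close> are determined: for \<open>\<phi> = 0\<close> the former alone would hold trivially.\<close>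

definition determined_by_samples :: "'n::finite cvec \<Rightarrow> bool" where
  "determined_by_samples \<phi> \<longleftrightarrow>
     (\<forall>f. f \<noteq> 0 \<longrightarrow> (\<forall>\<Lambda>. card \<Lambda> = CARD('n) \<longrightarrow>
        (\<forall>g. (\<forall>p\<in>\<Lambda>. stft \<phi> g $ p = stft \<phi> f $ p) \<longrightarrow> stft \<phi> g = stft \<phi> f \<and> g = f)))"

text \<open>The bound is \<open>|\<Lambda>| \<le> N\<close>: with equality \<open>|\<Lambda>| = N\<close> the equivalence
  would fail for every window, because the zero space, spanned by \<open>\<Lambda> = {}\<close>, is identifiable.\<close>

definition identifiability_criterion :: "'n::finite cvec \<Rightarrow> bool" where
  "identifiability_criterion \<phi> \<longleftrightarrow>
     (\<forall>\<Lambda>. identifiable (operator_span \<Lambda>) \<phi> \<longleftrightarrow> card \<Lambda> \<le> CARD('n))"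

end

theory Submission
  imports Defs
begin

text \<open>
  All six conditions say the same thing about the window \<open>\<phi>\<close>: any \<open>N\<close> of the \<open>N\<^sup>2\<close> vectors
  \<open>\<pi>(\<kappa>, \<lambda>)\<phi>\<close> are linearly independent, that is, every determinant \<open>det (gabor_matrix \<phi> e)\<close> with
  \<open>e\<close> injective is nonzero (\<open>gabor_generic\<close>). Minors of \<open>A\<^sub>\<phi>\<close> are conjugates of these determinants
  up to sign; a square system of sampling functionals \<open>f \<mapsto> \<langle>f, \<pi>(\<kappa>, \<lambda>)\<phi>\<rangle>\<close> is injective exactly
  when its determinant is nonzero, which accounts for the support and sampling conditions; the
  full Gabor system of a nonzero window is always an equal norm tight frame (\<open>gabor_energy\<close>), so
  robustness is the only content of the frame condition; and since the time-frequency shifts are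
  linearly independent operators, \<open>H \<mapsto> H\<phi>\<close> is injective on \<open>\<H>\<^sub>\<Lambda>\<close> exactly when the vectors indexed
  by \<open>\<Lambda>\<close> are independent.

  It remains to see that almost every window is generic. There are finitely many determinants, and
  each is a homogeneous polynomial in \<open>\<phi>\<close>. If it is nonzero at some window \<open>v\<close>, it vanishes at only
  finitely many points of each line in direction \<open>v\<close>, and Fubini's theorem makes its zero set null.

  The heart of the matter is thus to find, for each \<open>\<Lambda>\<close> of size \<open>N\<close>, one window whose determinant does
  not vanish (\<open>exists_window_det_nonzero\<close>). For prime \<open>N\<close> one could invoke Chebotarev's theorem on
  minors of the Fourier matrix, which fails for composite \<open>N\<close>. Minors formed from consecutive
  rows, however, are Vandermonde determinants up to nonzero factors, whatever \<open>N\<close> is. The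
  determinant is therefore evaluated along the degenerating windows
  \<open>\<phi>\<^sub>i = exp (- n F(i + s))\<close> with \<open>F(x) = x\<^sup>2 + N x\<close> on
  \<open>{0..<N}\<close>, for \<open>n \<rightarrow> \<infinity>\<close>. The dominant term pairs the coordinates
  \<open>j\<close> with the shifts \<open>\<kappa>\<close> so as to minimise \<open>\<Sum> F((j - \<kappa> + s) mod N)\<close>. The linear part of \<open>F\<close> penalises
  wrapping around modulo \<open>N\<close>, and by the rearrangement inequality its quadratic part forces the
  pairing to be monotone; so coordinates belonging to one shift form an interval. A monotone pairing
  without wrapping exists for a suitable rotation \<open>s\<close> by the cycle lemma. The rearrangement
  inequality is used in dual form: explicit potentials (\<open>potential_gap\<close>) provide row and column
  scalings under which the matrix converges to a block matrix whose blocks are Vandermonde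
  matrices on intervals of coordinates.
\<close>

section \<open>Residues and roots of unity\<close>

abbreviation res :: "nat \<Rightarrow> 'n::finite mod_ring" where
  "res m \<equiv> of_int_mod_ring (int m)"

lemma rep_less: "rep (k :: 'n::finite mod_ring) < CARD('n)"
  unfolding rep_def by transfer auto

lemma res_rep [simp]: "res (rep k) = (k :: 'n::finite mod_ring)"
  unfolding rep_def by transfer auto

lemma rep_res: "m < CARD('n) \<Longrightarrow> rep (res m :: 'n::finite mod_ring) = m"
  unfolding rep_def by simp

lemma rep_inject [simp]: "rep j = rep k \<longleftrightarrow> j = (k :: 'n::finite mod_ring)"
  by (metis res_rep)

lemma bij_betw_rep: "bij_betw rep (UNIV :: 'n::finite mod_ring set) {..<CARD('n)}"
  by (rule bij_betwI[where g = res]) (auto simp: rep_less rep_res)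

lemma rep_diff:
  "rep (a - b :: 'n::finite mod_ring) =
     (if rep b \<le> rep a then rep a - rep b else rep a + CARD('n) - rep b)"
proof -
  have *: "(x - y) mod int CARD('n) = (if y \<le> x then x - y else x + int CARD('n) - y)"
    if "x \<in> {0..<int CARD('n)}" "y \<in> {0..<int CARD('n)}" for x y
  proof -
    have "(x - y) mod int CARD('n) = x - y" if "y \<le> x"
      using that \<open>x \<in> _\<close> \<open>y \<in> _\<close> by (intro mod_pos_pos_trivial) auto
    moreover have "(x - y) mod int CARD('n) = x + int CARD('n) - y" if "\<not> y \<le> x"
    proof -
      have "(x - y) mod int CARD('n) = (x + int CARD('n) - y) mod int CARD('n)"
        using mod_add_self2[of "x - y" "int CARD('n)"] by (simp only: diff_add_eq)
      also have "\<dots> = x + int CARD('n) - y"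
        using that \<open>x \<in> _\<close> \<open>y \<in> _\<close> by (intro mod_pos_pos_trivial) auto
      finally show ?thesis .
    qed
    ultimately show ?thesis by simp
  qed
  show ?thesis
    unfolding rep_def by transfer (auto simp: *)
qed

text \<open>
  The powers \<open>\<omega>\<^sup>j\<close> of the primitive root of unity. They are the nodes of the Vandermonde matrices below,
  and \<open>node l ^ rep k\<close> is the value \<open>\<omega>\<^sup>l\<^sup>k\<close> of a character.
\<close>

definition node :: "'n::finite mod_ring \<Rightarrow> complex" where
  "node j = exp (2 * of_real pi * \<i> / of_nat CARD('n)) ^ rep j"

lemma node_eq: "node (j :: 'n::finite mod_ring) = exp (2 * of_real pi * \<i> * of_nat (rep j) / of_nat CARD('n))"
  unfolding node_def exp_of_nat_mult[symmetric] by (simp add: mult_ac)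

lemma inj_node: "inj (node :: 'n::finite mod_ring \<Rightarrow> complex)"
proof (rule injI)
  fix j k :: "'n mod_ring"
  assume "node j = node k"
  then have "rep j mod CARD('n) = rep k mod CARD('n)"
    unfolding node_eq using complex_root_unity_eq[of "CARD('n)" "rep j" "rep k"]
    by (simp add: Suc_le_eq)
  then show "j = k" using rep_less[of j] rep_less[of k] by simp
qed

lemma norm_node [simp]: "cmod (node j) = 1"
  unfolding node_eq norm_exp_eq_Re by simp

lemma node_nonzero [simp]: "node j \<noteq> 0"
  using norm_node[of j] by (metis norm_zero zero_neq_one)

lemma node_power_card: "node (j :: 'n::finite mod_ring) ^ CARD('n) = 1"
proof -
  have "node j ^ CARD('n) = exp (of_nat CARD('n) * (2 * of_real pi * \<i> * of_nat (rep j) / of_nat CARD('n)))"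
    unfolding node_eq by (rule exp_of_nat_mult[symmetric])
  also have "\<dots> = exp (2 * of_real pi * \<i>) ^ rep j"
    unfolding exp_of_nat_mult[symmetric] by (simp add: mult_ac)
  finally show ?thesis by simp
qed

lemma node_power_commute: "node j ^ rep k = node k ^ rep j" for j k :: "'n::finite mod_ring"
  unfolding node_def by (simp flip: power_mult add: mult.commute)

lemma node_orthogonality:
  fixes j k :: "'n::finite mod_ring"
  shows "(\<Sum>m\<in>(UNIV :: 'n mod_ring set). node m ^ rep j * cnj (node m ^ rep k)) = (if j = k then of_nat CARD('n) else 0)"
proof -
  let ?z = "node j * cnj (node k)"
  have "(\<Sum>m\<in>(UNIV :: 'n mod_ring set). node m ^ rep j * cnj (node m ^ rep k)) = (\<Sum>m\<in>UNIV. ?z ^ rep (m :: 'n mod_ring))"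
    by (intro sum.cong refl) (simp only: node_power_commute[of _ j] node_power_commute[of _ k] power_mult_distrib complex_cnj_power)
  also have "\<dots> = (\<Sum>m<CARD('n). ?z ^ m)"
    by (rule sum.reindex_bij_betw[OF bij_betw_rep])
  also have "\<dots> = (if j = k then of_nat CARD('n) else 0)"
  proof (cases "j = k")
    case True
    then have "?z = 1" by (simp add: complex_norm_square[symmetric])
    then show ?thesis using True by simp
  next
    case False
    have "?z \<noteq> 1"
    proof
      assume *: "?z = 1"
      have "node j = node j * (cnj (node k) * node k)"
        by (simp add: mult.commute[of "cnj _"] complex_norm_square[symmetric])
      also have "\<dots> = node k" using * by (simp flip: mult.assoc)
      finally show False using False by (simp add: inj_eq[OF inj_node])
    qed
    moreover have "?z ^ CARD('n) = 1"
      by (simp add: power_mult_distrib node_power_card flip: complex_cnj_power)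
    ultimately show ?thesis using False by (simp add: geometric_sum)
  qed
  finally show ?thesis .
qed

text \<open>
  If all power sums over a window of \<open>card B\<close> consecutive exponents vanish, so does
  \<open>\<Sum>c\<in>B. y c * \<xi> c ^ S * q (\<xi> c)\<close> for every polynomial \<open>q\<close> of degree less than \<open>card B\<close>. The Lagrange polynomial that
  is zero at every node but one isolates a single coefficient.
\<close>

lemma generalized_vandermonde_injective:
  fixes \<xi> y :: "'i \<Rightarrow> complex"
  assumes "finite B" and "inj_on \<xi> B" and "\<And>c. c \<in> B \<Longrightarrow> \<xi> c \<noteq> 0"
    and zero: "\<And>m. S \<le> m \<Longrightarrow> m < S + card B \<Longrightarrow> (\<Sum>c\<in>B. y c * \<xi> c ^ m) = 0"
    and "d \<in> B"
  shows "y d = 0"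
proof -
  define q where "q = (\<Prod>c\<in>B - {d}. [:- \<xi> c, 1:])"
  have deg: "degree q < card B"
  proof -
    have "degree q \<le> (\<Sum>c\<in>B - {d}. degree [:- \<xi> c, 1:])"
      unfolding q_def by (rule degree_prod_sum_le[unfolded o_def]) (use assms(1) in auto)
    also have "\<dots> = card B - 1" using assms(1,5) by simp
    also have "\<dots> < card B" using assms(1,5) by (metis card_gt_0_iff diff_less empty_iff zero_less_one)
    finally show ?thesis .
  qed
  have vanish: "poly q (\<xi> c) = 0" if "c \<in> B - {d}" for c
    unfolding q_def poly_prod using that assms(1) by auto
  have "poly q (\<xi> d) \<noteq> 0"
    unfolding q_def poly_prod using assms(1,2,5) by (auto simp: inj_on_def)
  have "(\<Sum>c\<in>B. y c * \<xi> c ^ S * poly q (\<xi> c)) = (\<Sum>i\<le>degree q. Polynomial.coeff q i * (\<Sum>c\<in>B. y c * \<xi> c ^ (S + i)))"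
    unfolding poly_altdef sum_distrib_left
    by (subst sum.swap) (simp add: power_add mult_ac)
  also have "\<dots> = 0"
    using deg by (intro sum.neutral ballI) (simp add: zero)
  finally have "y d * \<xi> d ^ S * poly q (\<xi> d) = 0"
    using vanish assms(1,5) by (simp add: sum.remove[of B d])
  then show ?thesis using \<open>poly q (\<xi> d) \<noteq> 0\<close> assms(3,5) by simp
qed

section \<open>Coordinates of time-frequency shifts\<close>

lemma shift_op_power: "(shift_op ^^ m) x $ j = x $ (j - res m)" for x :: "'n::finite cvec"
proof (induction m arbitrary: j)
  case 0
  have "j - res 0 = j" by simp
  then show ?case by simp
next
  case (Suc m)
  have "j - of_int_mod_ring 1 - res m = j - res (Suc m)"
    by transfer (simp add: mod_simps algebra_simps)
  moreover have "(shift_op ^^ Suc m) x $ j = (shift_op ^^ m) x $ (j - of_int_mod_ring 1)"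
    by (simp add: shift_op_def)
  ultimately show ?case by (simp only: Suc.IH)
qed

lemma modulation_op_power: "(modulation_op ^^ m) x $ j = node j ^ m * x $ j" for x :: "'n::finite cvec"
  by (induction m) (simp_all add: modulation_op_def node_def)

lemma gabor_nth: "gabor \<phi> p $ j = node (snd p) ^ rep j * \<phi> $ (j - fst p)"
  by (simp add: gabor_def tf_shift_def shift_op_power modulation_op_power node_power_commute)

section \<open>A staircase enumeration of the index set\<close>

text \<open>
  The cycle lemma. If \<open>N\<close> objects are placed at \<open>N\<close> positions on a circle, then from a suitable starting
  point \<open>s\<close> the first \<open>m\<close> positions always carry at least \<open>m\<close> objects: start where the surplus of objects
  over positions, counted from an arbitrary origin, is minimal.
\<close>

lemma cycle_lemma:
  fixes \<kappa> :: "'i \<Rightarrow> 'n::finite mod_ring"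
  assumes fin: "finite \<Lambda>" and card: "card \<Lambda> = CARD('n)"
  shows "\<exists>s. \<forall>m\<le>CARD('n). m \<le> card {p \<in> \<Lambda>. rep (\<kappa> p - s) < m}"
proof -
  define N where "N = CARD('n)"
  define count where "count m = card {p \<in> \<Lambda>. rep (\<kappa> p) < m}" for m
  define surplus where "surplus m = int (count m) - int m" for m
  have "0 < N" by (simp add: N_def)
  have count_N: "count N = N"
    by (simp add: count_def N_def rep_less card)
  have count_diff: "card {p \<in> \<Lambda>. l \<le> rep (\<kappa> p) \<and> rep (\<kappa> p) < u} = count u - count l" if "l \<le> u" for l u
  proof -
    have "{p \<in> \<Lambda>. l \<le> rep (\<kappa> p) \<and> rep (\<kappa> p) < u} = {p \<in> \<Lambda>. rep (\<kappa> p) < u} - {p \<in> \<Lambda>. rep (\<kappa> p) < l}"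
      by auto
    moreover have "{p \<in> \<Lambda>. rep (\<kappa> p) < l} \<subseteq> {p \<in> \<Lambda>. rep (\<kappa> p) < u}" using that by auto
    ultimately show ?thesis using fin by (simp add: count_def card_Diff_subset)
  qed
  have count_mono: "count l \<le> count u" if "l \<le> u" for l u
    unfolding count_def using that fin by (intro card_mono) auto
  obtain S where S: "S < N" "\<And>m. m < N \<Longrightarrow> surplus S \<le> surplus m"
  proof -
    have "finite (surplus ` {..<N})" "surplus ` {..<N} \<noteq> {}" using \<open>0 < N\<close> by auto
    then have "Min (surplus ` {..<N}) \<in> surplus ` {..<N}" by (rule Min_in)
    then obtain S where "S < N" "surplus S = Min (surplus ` {..<N})" by auto
    then show ?thesis by (intro that[of S]) auto
  qed
  have S_le: "surplus S \<le> surplus m" if "m \<le> N" for m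
  proof (cases "m = N")
    case True
    have "surplus S \<le> surplus 0" using \<open>0 < N\<close> S(2) by blast
    also have "surplus 0 = surplus N" by (simp add: surplus_def count_N) (simp add: count_def)
    finally show ?thesis using True by simp
  qed (use that S(2) in auto)
  define s :: "'n mod_ring" where "s = res S"
  have rep_s: "rep s = S" using S(1) by (simp add: s_def N_def rep_res)
  have "m \<le> card {p \<in> \<Lambda>. rep (\<kappa> p - s) < m}" if m: "m \<le> N" for m
  \<comment> \<open>The arc of length \<open>m\<close> starting at \<open>S\<close> may run past the origin.\<close>
  proof (cases "S + m \<le> N")
    case True
    have "{p \<in> \<Lambda>. rep (\<kappa> p - s) < m} = {p \<in> \<Lambda>. S \<le> rep (\<kappa> p) \<and> rep (\<kappa> p) < S + m}"
    proof (intro Collect_cong conj_cong refl)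
      fix p
      show "rep (\<kappa> p - s) < m \<longleftrightarrow> S \<le> rep (\<kappa> p) \<and> rep (\<kappa> p) < S + m"
        using True rep_less[of "\<kappa> p"] unfolding rep_diff rep_s N_def by auto
    qed
    then have "card {p \<in> \<Lambda>. rep (\<kappa> p - s) < m} = count (S + m) - count S"
      using count_diff by simp
    then show ?thesis
      using S_le[OF True] count_mono[of S "S + m"] by (simp add: surplus_def)
  next
    case False
    have *: "{p \<in> \<Lambda>. rep (\<kappa> p - s) < m} =
        {p \<in> \<Lambda>. S \<le> rep (\<kappa> p) \<and> rep (\<kappa> p) < N} \<union> {p \<in> \<Lambda>. rep (\<kappa> p) < S + m - N}"
    proof -
      have "rep (\<kappa> p - s) < m \<longleftrightarrow> S \<le> rep (\<kappa> p) \<and> rep (\<kappa> p) < N \<or> rep (\<kappa> p) < S + m - N" for p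
        using False m S(1) rep_less[of "\<kappa> p"] unfolding rep_diff rep_s N_def by auto
      then show ?thesis by auto
    qed
    have "{p \<in> \<Lambda>. S \<le> rep (\<kappa> p) \<and> rep (\<kappa> p) < N} \<inter> {p \<in> \<Lambda>. rep (\<kappa> p) < S + m - N} = {}"
      using m by auto
    then have "card {p \<in> \<Lambda>. rep (\<kappa> p - s) < m} = N - count S + count (S + m - N)"
      using * fin S(1) count_diff[of S N] by (simp add: card_Un_disjoint count_N) (simp add: count_def)
    then show ?thesis
      using S_le[of "S + m - N"] count_mono[of S N] S(1) m False unfolding surplus_def count_N by linarith
  qed
  then show ?thesis unfolding N_def by blast
qed

lemma sorted_enumeration:
  fixes key :: "'i \<Rightarrow> nat"
  assumes "finite \<Lambda>"
  obtains e where "bij_betw e {..<card \<Lambda>} \<Lambda>"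
    and "\<And>x y. x \<le> y \<Longrightarrow> y < card \<Lambda> \<Longrightarrow> key (e x) \<le> key (e y)"
proof -
  obtain xs where xs: "set xs = \<Lambda>" "distinct xs"
    using assms finite_distinct_list by blast
  define ys where "ys = sort_key key xs"
  have ys: "set ys = \<Lambda>" "distinct ys" "sorted (map key ys)" "length ys = card \<Lambda>"
    using xs by (auto simp: ys_def distinct_card)
  show ?thesis
  proof (rule that[of "(!) ys"])
    show "bij_betw ((!) ys) {..<card \<Lambda>} \<Lambda>"
      using ys by (intro bij_betw_nth) auto
    show "key (ys ! x) \<le> key (ys ! y)" if "x \<le> y" "y < card \<Lambda>" for x y
      using sorted_nth_mono[OF ys(3) that(1)] that ys(4) by simp
  qed
qed

text \<open>
  Sorting the index set by rotated time shift \<open>k\<close> yields a monotone pairing of coordinates with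
  shifts. The cycle lemma gives \<open>k \<le> j\<close> for every coordinate \<open>j\<close>, so \<open>j - k\<close> need not be reduced
  modulo \<open>N\<close> along this pairing.
\<close>

lemma staircase_enumeration:
  fixes \<Lambda> :: "'n::finite tf set"
  assumes "card \<Lambda> = CARD('n)"
  shows "\<exists>(e :: 'n mod_ring \<Rightarrow> 'n tf) s. bij_betw e UNIV \<Lambda> \<and>
    (\<forall>i j. rep i \<le> rep j \<longrightarrow> rep (fst (e i) - s) \<le> rep (fst (e j) - s)) \<and>
    (\<forall>i. rep (fst (e i) - s) \<le> rep i)"
proof -
  obtain s :: "'n mod_ring" where s: "\<And>m. m \<le> CARD('n) \<Longrightarrow> m \<le> card {p \<in> \<Lambda>. rep (fst p - s) < m}"
    using cycle_lemma[of \<Lambda> fst] assms finite by blast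
  define key where "key p = rep (fst p - s)" for p :: "'n tf"
  obtain e where e: "bij_betw e {..<CARD('n)} \<Lambda>"
    and mono: "\<And>x y. x \<le> y \<Longrightarrow> y < CARD('n) \<Longrightarrow> key (e x) \<le> key (e y)"
    using sorted_enumeration[of \<Lambda> key] assms by auto
  have le: "key (e x) \<le> x" if x: "x < CARD('n)" for x
  proof (rule ccontr)
    assume gt: "\<not> key (e x) \<le> x"
    \<comment> \<open>If position \<open>x\<close> had key above \<open>x\<close>, at most \<open>x\<close> objects would have key at most \<open>x\<close>.\<close>
    have "{p \<in> \<Lambda>. key p < Suc x} \<subseteq> e ` {..<x}"
    proof
      fix p assume p: "p \<in> {p \<in> \<Lambda>. key p < Suc x}"
      then obtain y where y: "y < CARD('n)" "p = e y"
        using e by (auto simp: bij_betw_def)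
      have "y < x"
        using mono[of x y] y p gt by (cases "x \<le> y") auto
      then show "p \<in> e ` {..<x}" using y by auto
    qed
    then have "card {p \<in> \<Lambda>. key p < Suc x} \<le> card (e ` {..<x})"
      by (rule card_mono[rotated]) simp
    also have "\<dots> \<le> x" using card_image_le[of "{..<x}" e] by simp
    finally have "card {p \<in> \<Lambda>. key p < Suc x} \<le> x" .
    then show False using s[of "Suc x"] x by (simp add: key_def)
  qed
  show ?thesis
  proof (intro exI[of _ "e \<circ> rep"] exI[of _ s] conjI)
    show "bij_betw (e \<circ> rep) (UNIV :: 'n mod_ring set) \<Lambda>"
      by (rule bij_betw_trans[OF bij_betw_rep e])
  qed (use mono le rep_less in \<open>auto simp: key_def\<close>)
qed

section \<open>Potentials for the monotone pairing\<close>

text \<open>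
  The trapezoidal primitive of \<open>2 k\<close>. For monotone \<open>k\<close> it is convex, and its slopes bracket \<open>2 k z\<close> exactly at those
  \<open>x\<close> with \<open>k x = k z\<close>. Together with its Legendre transform it solves the linear program dual to
  maximising \<open>\<Sum> 2 x k(\<sigma> x)\<close> over permutations \<open>\<sigma>\<close>.
\<close>

definition potential :: "(nat \<Rightarrow> real) \<Rightarrow> nat \<Rightarrow> real" where
  "potential k x = (\<Sum>y<x. k y + k (Suc y))"

text \<open>
  The tangent inequality for the convex function \<open>potential k\<close>. It is strict whenever \<open>k x \<noteq> k z\<close>, and this
  strictness makes the dominant term of the determinant unique. The slack \<open>\<bar>k x - k z\<bar>\<close> is carried along because
  it makes the induction hypotheses strong enough.
\<close>

lemma potential_gap:
  assumes mono: "mono_on {..<n} k" and "x < n" and "z < n"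
  shows "\<bar>k x - k z\<bar> \<le> potential k x - potential k z - 2 * (real x - real z) * k z"
proof (cases "z \<le> x")
  case True
  then have "k x - k z \<le> potential k x - potential k z - 2 * (real x - real z) * k z"
    using \<open>x < n\<close>
  proof (induction x rule: dec_induct)
    case (step x)
    have "k z \<le> k x" using step by (intro mono_onD[OF mono]) auto
    then show ?case using step by (simp add: potential_def algebra_simps)
  qed simp
  moreover have "k z \<le> k x" using True assms by (intro mono_onD[OF mono]) auto
  ultimately show ?thesis by simp
next
  case False
  then have "x \<le> z" by simp
  then have "k z - k x \<le> potential k x - potential k z - 2 * (real x - real z) * k z"
    using \<open>z < n\<close>
  proof (induction z rule: dec_induct)
    case (step z)
    have "k z \<le> k (Suc z)" using step by (intro mono_onD[OF mono]) auto
    then have "(real z - real x) * k z \<le> (real z - real x) * k (Suc z)"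
      using step by (intro mult_left_mono) auto
    then show ?case using step by (simp add: potential_def algebra_simps)
  qed simp
  moreover have "k x \<le> k z" using \<open>x \<le> z\<close> assms by (intro mono_onD[OF mono]) auto
  ultimately show ?thesis by simp
qed

section \<open>A window with nonvanishing determinant\<close>

definition gabor_matrix :: "'n::finite cvec \<Rightarrow> ('n mod_ring \<Rightarrow> 'n tf) \<Rightarrow> complex ^ 'n mod_ring ^ 'n mod_ring" where
  "gabor_matrix \<phi> e = (\<chi> c. gabor \<phi> (e c))"

lemma det_nonzero_iff_rows:
  fixes A :: "complex ^ 'd::finite ^ 'd"
  shows "det A \<noteq> 0 \<longleftrightarrow> (\<forall>y. (\<forall>j. (\<Sum>i\<in>UNIV. y i * A $ i $ j) = 0) \<longrightarrow> (\<forall>i. y i = 0))"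
  unfolding invertible_det_nz[symmetric] invertible_right_inverse matrix_right_invertible_independent_rows
  by (simp add: vec_eq_iff row_def)

lemma det_scale_rows_columns:
  fixes A :: "'a::comm_ring_1 ^ 'd::finite ^ 'd"
  shows "det (\<chi> i j. r i * A $ i $ j * c j) = prod r UNIV * prod c UNIV * det A"
proof -
  have "(\<Prod>i\<in>UNIV. c (p i)) = prod c UNIV" if "p permutes UNIV" for p
    using prod.permute[OF that, of c] by (simp add: o_def)
  then show ?thesis
    by (auto simp: det_def prod.distrib sum_distrib_left mult_ac intro!: sum.cong)
qed

lemma tendsto_det:
  fixes A :: "nat \<Rightarrow> complex ^ 'd::finite ^ 'd"
  assumes "\<And>i j. (\<lambda>n. A n $ i $ j) \<longlonglongrightarrow> B $ i $ j"
  shows "(\<lambda>n. det (A n)) \<longlonglongrightarrow> det B"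
  unfolding det_def by (intro tendsto_intros assms)

lemma nat_interval_eqI:
  fixes X :: "nat set"
  assumes "finite X" and "\<And>x y z. x \<in> X \<Longrightarrow> z \<in> X \<Longrightarrow> x \<le> y \<Longrightarrow> y \<le> z \<Longrightarrow> y \<in> X"
  obtains S where "X = {S..<S + card X}"
proof (cases "X = {}")
  case True
  then show ?thesis using that by simp
next
  case False
  have "X = {Min X..Max X}"
  proof (intro equalityI subsetI)
    fix y assume "y \<in> {Min X..Max X}"
    then show "y \<in> X"
      using assms(2)[of "Min X" "Max X" y] assms(1) False by simp
  qed (use assms(1) in simp)
  then have "card X = Suc (Max X) - Min X" by (metis card_atLeastAtMost)
  moreover have "Min X \<le> Max X" using False assms(1) by simp
  ultimately have "{Min X..Max X} = {Min X..<Min X + card X}" by auto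
  then show ?thesis using \<open>X = {Min X..Max X}\<close> that[of "Min X"] by simp
qed

text \<open>
  The limit matrix. Monotonicity of \<open>k\<close> turns each level set of \<open>k\<close> into an interval of
  coordinates, so the square block on it consists of consecutive powers of distinct roots of unity.
\<close>

lemma det_block_vandermonde_nonzero:
  fixes e :: "'n::finite mod_ring \<Rightarrow> 'n tf" and k :: "'n mod_ring \<Rightarrow> nat"
  assumes mono: "\<And>i j. rep i \<le> rep j \<Longrightarrow> k i \<le> k j"
    and inj: "\<And>i j. k i = k j \<Longrightarrow> snd (e i) = snd (e j) \<Longrightarrow> i = j"
  shows "det (\<chi> c j. if k c = k j then node (snd (e c)) ^ rep j else 0) \<noteq> 0"
  unfolding det_nonzero_iff_rows
proof (intro allI impI)
  fix y :: "'n mod_ring \<Rightarrow> complex" and d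
  assume "\<forall>j. (\<Sum>c\<in>UNIV. y c * (\<chi> c j. if k c = k j then node (snd (e c)) ^ rep j else 0) $ c $ j) = 0"
  then have zero: "(\<Sum>c\<in>UNIV. y c * (if k c = k j then node (snd (e c)) ^ rep j else 0)) = 0" for j
    by simp
  define B where "B = {c. k c = k d}"
  have "\<exists>S. rep ` B = {S..<S + card (rep ` B)}"
  proof (rule nat_interval_eqI)
    fix x v z assume xz: "x \<in> rep ` B" "z \<in> rep ` B" "x \<le> v" "v \<le> z"
    then obtain i j where ij: "x = rep i" "z = rep j" "k i = k d" "k j = k d" 
      by (auto simp: B_def)
    have "v < CARD('n)" using xz ij rep_less[of j] by simp
    then have v: "rep (res v :: 'n mod_ring) = v" by (rule rep_res)
    then have "k (res v) = k d"
      using mono[of i "res v"] mono[of "res v" j] xz ij by simp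
    then show "v \<in> rep ` B"
      by (intro image_eqI[of _ _ "res v"]) (simp_all add: v B_def)
  qed auto
  then obtain S where "rep ` B = {S..<S + card (rep ` B)}" ..
  also have "card (rep ` B) = card B"
    by (rule card_image) (simp add: inj_on_def)
  finally have S: "rep ` B = {S..<S + card B}" .
  show "y d = 0"
  proof (rule generalized_vandermonde_injective[of B "\<lambda>c. node (snd (e c))" S y])
    show "inj_on (\<lambda>c. node (snd (e c))) B"
    proof (rule inj_onI)
      fix c c' assume "c \<in> B" "c' \<in> B" "node (snd (e c)) = node (snd (e c'))"
      then have "k c = k c'" "snd (e c) = snd (e c')"
        by (simp_all add: B_def inj_eq[OF inj_node])
      then show "c = c'" by (rule inj)
    qed
    fix m assume "S \<le> m" "m < S + card B"
    then have "m \<in> rep ` B" using S by auto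
    then obtain j where j: "m = rep j" "k j = k d" by (auto simp: B_def)
    have "(\<Sum>c\<in>B. y c * node (snd (e c)) ^ m) =
        (\<Sum>c\<in>UNIV. y c * (if k c = k j then node (snd (e c)) ^ rep j else 0))"
      by (rule sum.mono_neutral_cong_left) (auto simp: B_def j)
    then show "(\<Sum>c\<in>B. y c * node (snd (e c)) ^ m) = 0" using zero by simp
  qed (auto simp: B_def)
qed

text \<open>
  Write \<open>x = rep j\<close>, \<open>z = rep c\<close> and \<open>u\<close> for the potential. The exponent \<open>F (rep (j - \<kappa> + s))\<close> of the
  window entry in row \<open>c\<close> and column \<open>j\<close> splits as \<open>a j + b c + excess c j\<close>. Rescaling columns by
  \<open>exp (n * a j)\<close> and rows by \<open>exp (n * b c)\<close> leaves \<open>exp (- n * excess c j)\<close>, where the excess vanishes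
  inside the blocks \<open>k c = k j\<close> and is positive elsewhere.
\<close>

lemma exists_window_det_nonzero:
  fixes \<Lambda> :: "'n::finite tf set"
  assumes "card \<Lambda> = CARD('n)"
  obtains \<phi> and e where "bij_betw e UNIV \<Lambda>" and "det (gabor_matrix \<phi> e) \<noteq> 0"
proof -
  obtain e :: "'n mod_ring \<Rightarrow> 'n tf" and s where e: "bij_betw e UNIV \<Lambda>"
    and staircase: "\<forall>i j. rep i \<le> rep j \<longrightarrow> rep (fst (e i) - s) \<le> rep (fst (e j) - s)"
      "\<forall>i. rep (fst (e i) - s) \<le> rep i"
    using staircase_enumeration[OF assms] by (elim exE conjE)
  define N where "N = real CARD('n)"
  define k where "k c = rep (fst (e c) - s)" for c :: "'n mod_ring"
  have mono: "k i \<le> k j" if "rep i \<le> rep j" for i j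
    using staircase(1) that by (simp add: k_def)
  have le: "k i \<le> rep i" for i
    using staircase(2) by (simp add: k_def)
  define F where "F x = (real x)\<^sup>2 + N * real x" for x
  define u where "u = potential (\<lambda>x. real (k (res x)))"
  define a where "a j = (real (rep j))\<^sup>2 + N * real (rep j) - u (rep j)" for j :: "'n mod_ring"
  define b where "b c = (real (k c))\<^sup>2 - N * real (k c) - 2 * real (rep c) * real (k c) + u (rep c)" for c :: "'n mod_ring"
  define excess where "excess c j = F (rep (j - fst (e c) + s)) - a j - b c" for c j

  have mono_k: "mono_on {..<CARD('n)} (\<lambda>x. real (k (res x)))"
    by (intro mono_onI) (simp add: mono rep_res)
  have gap: "\<bar>real (k j) - real (k c)\<bar> \<le> u (rep j) - u (rep c) - 2 * (real (rep j) - real (rep c)) * real (k c)" for c j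
    using potential_gap[OF mono_k rep_less[of j] rep_less[of c]] by (simp add: u_def)
  \<comment> \<open>The excess consists of the convexity gap of the potential and the price of wrapping around, \<open>F (y + N) - F y = 2 * N * (y + N)\<close> at \<open>y = rep j - k c\<close>.\<close>
  have excess_eq: "excess c j = u (rep j) - u (rep c) - 2 * (real (rep j) - real (rep c)) * real (k c)
      + (if k c \<le> rep j then 0 else 2 * N * (real (rep j) - real (k c) + N))" for c j
  proof -
    have "j - fst (e c) + s = j - (fst (e c) - s)" by simp
    then have "rep (j - fst (e c) + s) = (if k c \<le> rep j then rep j - k c else rep j + CARD('n) - k c)"
      by (simp only: rep_diff k_def)
    moreover have "k c < CARD('n)" by (simp add: k_def rep_less)
    ultimately have shift: "real (rep (j - fst (e c) + s)) = real (rep j) - real (k c) + (if k c \<le> rep j then 0 else N)"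
      by (simp add: N_def)
    show ?thesis
      unfolding excess_def F_def a_def b_def shift by (simp add: power2_eq_square algebra_simps)
  qed
  \<comment> \<open>The gaps for \<open>(c, j)\<close> and \<open>(j, c)\<close> are nonnegative and cancel each other when \<open>k c = k j\<close>; and
    \<open>k j \<le> rep j\<close> excludes wrapping.\<close>
  have excess_zero: "excess c j = 0" if "k c = k j" for c j
    using gap[of j c] gap[of c j] that le[of j] by (simp add: excess_eq algebra_simps)
  have excess_pos: "excess c j > 0" if "k c \<noteq> k j" for c j
  proof -
    have "k c < CARD('n)" by (simp add: k_def rep_less)
    then have "0 \<le> (if k c \<le> rep j then 0 else 2 * N * (real (rep j) - real (k c) + N))"
      by (auto simp: N_def)
    moreover have "0 < \<bar>real (k j) - real (k c)\<bar>" using that by simp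
    ultimately show ?thesis using gap[of j c] unfolding excess_eq by linarith
  qed

  define \<phi> :: "nat \<Rightarrow> 'n cvec" where "\<phi> n = (\<chi> i. of_real (exp (- real n * F (rep (i + s)))))" for n
  define G where "G n = (\<chi> c j. of_real (exp (real n * b c)) * gabor_matrix (\<phi> n) e $ c $ j * of_real (exp (real n * a j)))" for n
  define D where "D = (\<chi> c j. if k c = k j then node (snd (e c)) ^ rep j else 0)"
  have G_entry: "G n $ c $ j = node (snd (e c)) ^ rep j * of_real (exp (- excess c j) ^ n)" for n c j
  proof -
    have "exp (real n * b c) * exp (- real n * F (rep (j - fst (e c) + s))) * exp (real n * a j) = exp (- excess c j) ^ n"
      by (simp add: excess_def algebra_simps flip: exp_add exp_of_nat_mult)
    then have "complex_of_real (exp (real n * b c)) * of_real (exp (- real n * F (rep (j - fst (e c) + s)))) * of_real (exp (real n * a j)) = of_real (exp (- excess c j) ^ n)"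
      by (simp only: of_real_mult[symmetric])
    then show ?thesis
      by (simp add: G_def gabor_matrix_def gabor_nth \<phi>_def mult_ac)
  qed
  have "(\<lambda>n. G n $ c $ j) \<longlonglongrightarrow> D $ c $ j" for c j
  proof (cases "k c = k j")
    case True
    then show ?thesis by (simp add: G_entry D_def excess_zero)
  next
    case False
    have "(\<lambda>n. exp (- excess c j) ^ n) \<longlonglongrightarrow> 0"
      using excess_pos[OF False] by (intro LIMSEQ_realpow_zero) auto
    then have "(\<lambda>n. node (snd (e c)) ^ rep j * of_real (exp (- excess c j) ^ n)) \<longlonglongrightarrow> node (snd (e c)) ^ rep j * of_real 0"
      by (intro tendsto_mult tendsto_const tendsto_of_real)
    then show ?thesis using False by (simp add: G_entry D_def)
  qed
  then have "(\<lambda>n. det (G n)) \<longlonglongrightarrow> det D" by (rule tendsto_det)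
  moreover have "det D \<noteq> 0"
    unfolding D_def
  proof (rule det_block_vandermonde_nonzero)
    show "i = j" if "k i = k j" "snd (e i) = snd (e j)" for i j
    proof -
      have "fst (e i) = fst (e j)" using that(1) by (simp add: k_def)
      then have "e i = e j" using that(2) by (rule prod_eqI)
      then show ?thesis by (rule injD[OF bij_betw_imp_inj_on[OF e]])
    qed
  qed (rule mono)
  ultimately have "eventually (\<lambda>n. det (G n) \<noteq> 0) sequentially"
    by (rule tendsto_imp_eventually_ne)
  then obtain n where "det (G n) \<noteq> 0"
    using eventually_happens'[OF sequentially_bot] by blast
  then have "det (gabor_matrix (\<phi> n) e) \<noteq> 0"
    unfolding G_def det_scale_rows_columns by auto
  with e show ?thesis by (rule that)
qed

section \<open>Zero sets of the determinants are null\<close>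

lemma poly_det:
  fixes M :: "'a::comm_ring_1 poly ^ 'd::finite ^ 'd"
  shows "poly (det M) t = det (\<chi> i j. poly (M $ i $ j) t)"
  by (simp add: det_def poly_sum poly_prod)

text \<open>
  For matrices of size \<open>d\<close>, homogeneity gives \<open>det (A + t B) = t\<^sup>d det (B + t\<^sup>-\<^sup>1 A)\<close> for \<open>t \<noteq> 0\<close>, and \<open>det (B + s A)\<close> is a polynomial in \<open>s\<close>
  that is nonzero at \<open>s = 0\<close>.
\<close>

lemma finite_singular_pencil:
  fixes A B :: "complex ^ 'd::finite ^ 'd"
  assumes "det B \<noteq> 0"
  shows "finite {t. det (\<chi> i j. A $ i $ j + t * B $ i $ j) = 0}"
proof -
  define P where "P = det (\<chi> i j. [:B $ i $ j, A $ i $ j:])"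
  have P: "poly P t = det (\<chi> i j. B $ i $ j + t * A $ i $ j)" for t
    by (simp add: P_def poly_det)
  have "P \<noteq> 0"
  proof
    assume "P = 0"
    then have "det B = poly 0 0" using P[of 0] by simp
    then show False using assms by simp
  qed
  have "{t. det (\<chi> i j. A $ i $ j + t * B $ i $ j) = 0} \<subseteq> insert 0 (inverse ` {t. poly P t = 0})"
  proof safe
    fix t assume t: "det (\<chi> i j. A $ i $ j + t * B $ i $ j) = 0" "t \<notin> inverse ` {t. poly P t = 0}"
    show "t = 0"
    proof (rule ccontr)
      assume "t \<noteq> 0"
      have "poly P (inverse t) = det (\<chi> i j. inverse t * (\<chi> i j. A $ i $ j + t * B $ i $ j) $ i $ j * 1)"
        unfolding P using \<open>t \<noteq> 0\<close> by (intro arg_cong[where f = det]) (simp add: vec_eq_iff field_simps)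
      also have "\<dots> = 0" by (subst det_scale_rows_columns) (simp add: t(1))
      finally have "t \<in> inverse ` {t. poly P t = 0}"
        by (intro image_eqI[of _ _ "inverse t"]) auto
      then show False using t(2) by simp
    qed
  qed
  then show ?thesis
    using poly_roots_finite[OF \<open>P \<noteq> 0\<close>] by (auto intro: finite_subset)
qed

text \<open>
  By Fubini's theorem some translate of \<open>S\<close> along \<open>v\<close> is null, and Lebesgue measure is translation invariant.
\<close>

lemma AE_lborel_if_finite_on_lines:
  fixes S :: "'a::euclidean_space set" and v :: 'a
  assumes S: "S \<in> sets borel" and fin: "\<And>x. finite {t :: real. x + t *\<^sub>R v \<in> S}"
  shows "AE x in lborel. x \<notin> S"
proof -
  have meas: "{z \<in> space (lborel \<Otimes>\<^sub>M lborel). fst z + snd z *\<^sub>R v \<notin> S} \<in> sets ((lborel :: 'a measure) \<Otimes>\<^sub>M (lborel :: real measure))"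
    using S by measurable
  have "AE x in lborel. AE t in lborel. x + t *\<^sub>R v \<notin> S"
  proof (rule AE_I2)
    fix x
    show "AE t in lborel. x + t *\<^sub>R v \<notin> S"
      by (rule AE_I'[OF finite_imp_null_set_lborel[OF fin[of x]]]) auto
  qed
  then have "AE t in lborel. AE x in lborel. x + t *\<^sub>R v \<notin> S"
    using lborel_pair.AE_commute[OF meas] by simp
  moreover have "ae_filter (lborel :: real measure) \<noteq> bot"
    by (simp add: ae_filter_eq_bot_iff)
  ultimately obtain t where "AE x in lborel. x + t *\<^sub>R v \<notin> S"
    using eventually_happens' by fast
  then have "AE x in lborel. (t *\<^sub>R v) + x \<notin> S" by (simp add: add.commute)
  moreover have "(AE x in distr lborel borel ((+) (t *\<^sub>R v)). x \<notin> S) \<longleftrightarrow> (AE x in lborel. (t *\<^sub>R v) + x \<notin> S)"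
    using S by (intro AE_distr_iff) auto
  ultimately show ?thesis unfolding lborel_distr_plus by (rule iffD2[rotated])
qed

lemma continuous_on_det_gabor_matrix: "continuous_on UNIV (\<lambda>\<phi>. det (gabor_matrix \<phi> e))"
  unfolding det_def gabor_matrix_def by (simp add: gabor_nth) (intro continuous_intros)

text \<open>
  The window \<open>v\<close> that makes the determinant nonzero also serves as the direction of the lines, since
  \<open>gabor_matrix\<close> is linear in the window.
\<close>

lemma AE_det_gabor_matrix_nonzero:
  fixes e :: "'n::finite mod_ring \<Rightarrow> 'n tf"
  assumes "inj e"
  shows "AE \<phi> in lborel. det (gabor_matrix \<phi> e) \<noteq> 0"
proof -
  define S where "S = {\<phi> :: 'n cvec. det (gabor_matrix \<phi> e) = 0}"
  have "card (range e) = CARD('n)" using assms by (simp add: card_image)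
  then obtain v e' where e': "bij_betw e' UNIV (range e)" and v': "det (gabor_matrix v e') \<noteq> 0"
    by (rule exists_window_det_nonzero)
  have v: "det (gabor_matrix v e) \<noteq> 0"
  proof -
    \<comment> \<open>The enumeration produced with \<open>v\<close> may list the same set in another order, which only permutes rows.\<close>
    have "\<exists>p. p permutes UNIV \<and> e' = e \<circ> p"
    proof (intro exI conjI)
      have "bij (inv_into UNIV e \<circ> e')"
        using bij_betw_trans[OF e' bij_betw_inv_into[OF inj_on_imp_bij_betw[OF assms]]] .
      then show "inv_into UNIV e \<circ> e' permutes UNIV" by (rule bij_imp_permutes) simp
      have "e' x \<in> range e" for x
        using bij_betw_imp_surj_on[OF e'] by blast
      then show "e' = e \<circ> (inv_into UNIV e \<circ> e')"
        by (simp add: fun_eq_iff f_inv_into_f)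
    qed
    then obtain p where p: "p permutes UNIV" "e' = e \<circ> p" by blast
    then have "gabor_matrix v e' = (\<chi> i. gabor_matrix v e $ p i)"
      by (simp add: gabor_matrix_def)
    then show ?thesis using v' det_permute_rows[OF p(1), of "gabor_matrix v e"] by auto
  qed
  have "AE x in lborel. x \<notin> S"
  proof (rule AE_lborel_if_finite_on_lines[where v = v])
    have "closed S"
      unfolding S_def using continuous_closed_vimage[of "{0}" "\<lambda>\<phi>. det (gabor_matrix \<phi> e)"]
        continuous_on_det_gabor_matrix[of e] 
      by (intro closed_Collect_eq) auto
    then show "S \<in> sets borel" by simp
    fix x :: "'n cvec"
    have line: "gabor_matrix (x + t *\<^sub>R v) e = (\<chi> i j. gabor_matrix x e $ i $ j + of_real t * gabor_matrix v e $ i $ j)" for t :: real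
      unfolding gabor_matrix_def vec_eq_iff by (simp add: gabor_nth algebra_simps scaleR_conv_of_real[symmetric])
    have "finite (of_real -` {t. det (\<chi> i j. gabor_matrix x e $ i $ j + t * gabor_matrix v e $ i $ j) = 0} :: real set)"
      by (intro finite_vimageI finite_singular_pencil v) (simp add: inj_on_def)
    then show "finite {t :: real. x + t *\<^sub>R v \<in> S}"
      by (simp add: S_def line vimage_def)
  qed
  then show ?thesis by (simp add: S_def)
qed

section \<open>Generic windows and linear independence\<close>

definition gabor_generic :: "'n::finite cvec \<Rightarrow> bool" where
  "gabor_generic \<phi> \<longleftrightarrow> (\<forall>e. inj e \<longrightarrow> det (gabor_matrix \<phi> e) \<noteq> 0)"

text \<open>
  The injectivity conjunct of \<open>lin_indep_family\<close> makes it the usual independence of indexed families, in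
  which a repeated vector is already a linear relation.
\<close>

lemma lin_indep_family_iff:
  assumes "finite K"
  shows "lin_indep_family v K \<longleftrightarrow> (\<forall>a. (\<Sum>p\<in>K. a p *s v p) = 0 \<longrightarrow> (\<forall>p\<in>K. a p = 0))"
    (is "_ \<longleftrightarrow> ?R")
proof
  assume L: "lin_indep_family v K"
  show ?R
  proof (intro allI impI)
    fix a assume a: "(\<Sum>p\<in>K. a p *s v p) = 0"
    have inj: "inj_on v K" and indep: "vec.independent (v ` K)"
      using L by (auto simp: lin_indep_family_def)
    have "(\<Sum>w\<in>v ` K. a (the_inv_into K v w) *s w) = (\<Sum>p\<in>K. a p *s v p)"
      unfolding sum.reindex[OF inj] by (intro sum.cong) (auto simp: the_inv_into_f_f[OF inj])
    then have zero: "(\<Sum>w\<in>v ` K. a (the_inv_into K v w) *s w) = 0"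
      using a by simp
    have indep': "(\<Sum>w\<in>v ` K. c w *s w) = 0 \<Longrightarrow> w \<in> v ` K \<Longrightarrow> c w = 0" for c w
      using indep unfolding vec.independent_explicit by blast
    have "\<forall>w\<in>v ` K. a (the_inv_into K v w) = 0"
      using indep'[OF zero] by blast
    then show "\<forall>p\<in>K. a p = 0" by (auto simp: the_inv_into_f_f[OF inj])
  qed
next
  assume ?R
  then have R: "(\<Sum>p\<in>K. a p *s v p) = 0 \<Longrightarrow> p \<in> K \<Longrightarrow> a p = 0" for a p by blast
  have inj: "inj_on v K"
  proof (rule inj_onI, rule ccontr)
    fix p q assume pq: "p \<in> K" "q \<in> K" "v p = v q" "p \<noteq> q"
    define a where "a r = (if r = p then 1 else if r = q then - 1 else 0 :: complex)" for r
    have "(\<Sum>r\<in>K. a r *s v r) = (\<Sum>r\<in>{p, q}. a r *s v r)"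
      using pq assms by (intro sum.mono_neutral_right) (auto simp: a_def)
    also have "\<dots> = 0" using pq by (simp add: a_def)
    finally have "a p = 0" using pq(1) by (rule R)
    then show False by (simp add: a_def)
  qed
  have "vec.independent (v ` K)"
    unfolding vec.dependent_finite[OF finite_imageI[OF assms]]
  proof
    assume "\<exists>u. (\<exists>w\<in>v ` K. u w \<noteq> 0) \<and> (\<Sum>w\<in>v ` K. u w *s w) = 0"
    then obtain u p where u: "p \<in> K" "u (v p) \<noteq> 0" "(\<Sum>w\<in>v ` K. u w *s w) = 0" by blast
    then have "(\<Sum>p\<in>K. u (v p) *s v p) = 0" by (simp add: sum.reindex[OF inj])
    then show False using R[of "\<lambda>p. u (v p)" p] u by simp
  qed
  with inj show "lin_indep_family v K" by (simp add: lin_indep_family_def)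
qed

lemma lin_indep_family_subset: "lin_indep_family v K \<Longrightarrow> J \<subseteq> K \<Longrightarrow> lin_indep_family v J"
  unfolding lin_indep_family_def by (meson image_mono inj_on_subset vec.independent_mono)

lemma basis_family_iff:
  fixes v :: "'k \<Rightarrow> complex ^ 'd::finite"
  assumes "card K = CARD('d)"
  shows "basis_family v K \<longleftrightarrow> lin_indep_family v K"
proof -
  have "vec.span (v ` K) = UNIV" if "lin_indep_family v K"
  proof -
    have indep: "vec.independent (v ` K)" and inj: "inj_on v K"
      using that by (auto simp: lin_indep_family_def)
    have "card (v ` K) = vec.dim (UNIV :: (complex ^ 'd) set)"
      unfolding vec_dim_card card_image[OF inj] by (rule assms)
    then have "UNIV \<subseteq> vec.span (v ` K)"
      using vec.card_eq_dim[of "v ` K" UNIV] indep vec.finiteI_independent[OF indep] by blast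
    then show ?thesis by blast
  qed
  then show ?thesis by (auto simp: basis_family_def)
qed

lemma index_set_enumeration:
  fixes \<Lambda> :: "'n::finite tf set"
  assumes "card \<Lambda> = CARD('n)"
  obtains e :: "'n mod_ring \<Rightarrow> 'n tf" where "inj e" "range e = \<Lambda>"
  using assms finite_same_card_bij[of "UNIV :: 'n mod_ring set" \<Lambda>]
  by (auto simp: bij_betw_def)

lemma det_gabor_matrix_nonzero_iff_lin_indep:
  assumes "inj e"
  shows "det (gabor_matrix \<phi> e) \<noteq> 0 \<longleftrightarrow> lin_indep_family (gabor \<phi>) (range e)"
proof -
  have "(\<Sum>p\<in>range e. a p *s gabor \<phi> p) = 0 \<longleftrightarrow> (\<forall>j. (\<Sum>i\<in>UNIV. a (e i) * gabor_matrix \<phi> e $ i $ j) = 0)" for a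
    by (simp add: sum.reindex[OF assms] vec_eq_iff gabor_matrix_def)
  then have "lin_indep_family (gabor \<phi>) (range e) \<longleftrightarrow>
      (\<forall>a. (\<forall>j. (\<Sum>i\<in>UNIV. a (e i) * gabor_matrix \<phi> e $ i $ j) = 0) \<longrightarrow> (\<forall>i. a (e i) = 0))"
    by (simp add: lin_indep_family_iff)
  also have "\<dots> \<longleftrightarrow> (\<forall>y. (\<forall>j. (\<Sum>i\<in>UNIV. y i * gabor_matrix \<phi> e $ i $ j) = 0) \<longrightarrow> (\<forall>i. y i = 0))"
  proof -
    have "\<exists>a. y = (\<lambda>i. a (e i))" for y :: "_ \<Rightarrow> complex"
      using assms by (intro exI[of _ "y \<circ> inv_into UNIV e"]) (simp add: fun_eq_iff)
    then have "(\<forall>y. Q y) \<longleftrightarrow> (\<forall>a. Q (\<lambda>i. a (e i)))" for Q :: "(_ \<Rightarrow> complex) \<Rightarrow> bool"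
      by metis
    from this[of "\<lambda>y. (\<forall>j. (\<Sum>i\<in>UNIV. y i * gabor_matrix \<phi> e $ i $ j) = 0) \<longrightarrow> (\<forall>i. y i = 0)"]
    show ?thesis by (rule sym)
  qed
  finally show ?thesis unfolding det_nonzero_iff_rows by simp
qed

lemma gabor_generic_iff_lin_indep:
  fixes \<phi> :: "'n::finite cvec"
  shows "gabor_generic \<phi> \<longleftrightarrow> (\<forall>\<Lambda>. card \<Lambda> = CARD('n) \<longrightarrow> lin_indep_family (gabor \<phi>) \<Lambda>)"
proof
  assume "gabor_generic \<phi>"
  then show "\<forall>\<Lambda>. card \<Lambda> = CARD('n) \<longrightarrow> lin_indep_family (gabor \<phi>) \<Lambda>"
    by (metis gabor_generic_def index_set_enumeration det_gabor_matrix_nonzero_iff_lin_indep)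
next
  assume "\<forall>\<Lambda>. card \<Lambda> = CARD('n) \<longrightarrow> lin_indep_family (gabor \<phi>) \<Lambda>"
  then show "gabor_generic \<phi>"
    by (simp add: gabor_generic_def det_gabor_matrix_nonzero_iff_lin_indep card_image)
qed

lemma full_gabor_glp_iff: "full_gabor_glp \<phi> \<longleftrightarrow> gabor_generic \<phi>"
  unfolding gabor_generic_iff_lin_indep full_gabor_glp_def general_linear_position_def
  by (simp add: basis_family_iff)

section \<open>Minors of the short-time Fourier transform\<close>

lemma det_cnj: "det (\<chi> i j. cnj (A $ i $ j)) = cnj (det A)" for A :: "complex ^ 'd::finite ^ 'd"
  by (simp add: det_def)

lemma hinner_axis: "hinner (axis j 1) g = cnj (g $ j)"
proof -
  have "hinner (axis j 1) g = (\<Sum>i\<in>UNIV. if i = j then cnj (g $ i) else 0)"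
    unfolding hinner_def by (intro sum.cong) (auto simp: axis_def)
  then show ?thesis by simp
qed

lemma minor_stft_matrix:
  assumes "inj c"
  shows "\<exists>\<epsilon>. \<epsilon> \<noteq> 0 \<and> minor (stft_matrix \<phi>) r c = \<epsilon> * cnj (det (gabor_matrix \<phi> r))"
proof -
  have c: "c permutes UNIV"
    using assms by (intro bij_imp_permutes) (simp_all add: finite_UNIV_inj_surj bij_def)
  define A where "A = (\<chi> i j. cnj (gabor_matrix \<phi> r $ i $ j))"
  have "minor (stft_matrix \<phi>) r c = det (\<chi> i j. A $ i $ c j)"
    by (simp add: minor_def stft_matrix_def matrix_def stft_def hinner_axis A_def gabor_matrix_def gabor_def)
  also have "\<dots> = of_int (sign c) * det A" by (rule det_permute_columns[OF c])
  also have "det A = cnj (det (gabor_matrix \<phi> r))" unfolding A_def by (rule det_cnj)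
  finally show ?thesis by (intro exI[of _ "of_int (sign c)"]) (simp add: sign_def)
qed

lemma all_minors_nonzero_iff: "all_minors_nonzero \<phi> \<longleftrightarrow> gabor_generic \<phi>"
proof
  assume "all_minors_nonzero \<phi>"
  then show "gabor_generic \<phi>"
    unfolding all_minors_nonzero_def gabor_generic_def
    using minor_stft_matrix[of id \<phi>] by (metis complex_cnj_zero inj_on_id mult_zero_right)
next
  assume "gabor_generic \<phi>"
  then show "all_minors_nonzero \<phi>"
    unfolding all_minors_nonzero_def gabor_generic_def
    using minor_stft_matrix by (metis complex_cnj_zero_iff mult_eq_0_iff)
qed

section \<open>Support and sampling\<close>

lemma stft_nth: "stft \<phi> f $ p = hinner f (gabor \<phi> p)"
  by (simp add: stft_def gabor_def)

lemma stft_diff: "stft \<phi> (f - g) $ p = stft \<phi> f $ p - stft \<phi> g $ p"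
  by (simp add: stft_nth hinner_def left_diff_distrib sum_subtractf)

text \<open>
  The map \<open>f \<mapsto> (\<langle>f, \<pi>(e i)\<phi>\<rangle>)\<^sub>i\<close> has as its matrix the entrywise conjugate of
  \<open>gabor_matrix \<phi> e\<close>.
\<close>

lemma det_gabor_matrix_nonzero_iff_stft:
  "det (gabor_matrix \<phi> e) \<noteq> 0 \<longleftrightarrow> (\<forall>f. (\<forall>p\<in>range e. stft \<phi> f $ p = 0) \<longrightarrow> f = 0)"
proof -
  define A where "A = transpose (\<chi> i j. cnj (gabor_matrix \<phi> e $ i $ j))"
  have "det A = cnj (det (gabor_matrix \<phi> e))"
    unfolding A_def det_transpose det_cnj ..
  moreover have "(\<Sum>i\<in>UNIV. y i * A $ i $ j) = stft \<phi> (vec_lambda y) $ e j" for y j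
    by (simp add: A_def transpose_def stft_nth hinner_def gabor_matrix_def)
  moreover have "(\<forall>y. Q (vec_lambda y) \<longrightarrow> (\<forall>i. y i = 0)) \<longleftrightarrow> (\<forall>f. Q f \<longrightarrow> f = 0)" for Q :: "'a cvec \<Rightarrow> bool"
    by (metis vec_eq_iff vec_lambda_beta vec_lambda_eta zero_index)
  ultimately show ?thesis
    using det_nonzero_iff_rows[of A] by simp
qed

lemma gabor_generic_iff_stft:
  fixes \<phi> :: "'n::finite cvec"
  shows "gabor_generic \<phi> \<longleftrightarrow>
    (\<forall>\<Lambda>. card \<Lambda> = CARD('n) \<longrightarrow> (\<forall>f. (\<forall>p\<in>\<Lambda>. stft \<phi> f $ p = 0) \<longrightarrow> f = 0))" (is "_ \<longleftrightarrow> ?R")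
proof
  assume G: "gabor_generic \<phi>"
  show ?R
  proof (intro allI impI)
    fix \<Lambda> :: "'n tf set" and f
    assume "card \<Lambda> = CARD('n)" and f: "\<forall>p\<in>\<Lambda>. stft \<phi> f $ p = 0"
    then obtain e :: "'n mod_ring \<Rightarrow> 'n tf" where "inj e" "range e = \<Lambda>"
      using index_set_enumeration by blast
    then show "f = 0"
      using G f det_gabor_matrix_nonzero_iff_stft[of \<phi> e] by (auto simp: gabor_generic_def)
  qed
next
  assume R: ?R
  show "gabor_generic \<phi>"
    unfolding gabor_generic_def det_gabor_matrix_nonzero_iff_stft
  proof (intro allI impI)
    fix e :: "'n mod_ring \<Rightarrow> 'n tf" and f
    assume "inj e" and f: "\<forall>p\<in>range e. stft \<phi> f $ p = 0"
    then have "card (range e) = CARD('n)" by (simp add: card_image)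
    then show "f = 0" using R f by blast
  qed
qed

text \<open>
  A support bound of \<open>N\<^sup>2 - N + 1\<close> means that the zero set of \<open>V\<^sub>\<phi>f\<close> contains no subset of size \<open>N\<close>.
\<close>

lemma large_stft_supp_iff: "large_stft_supp \<phi> \<longleftrightarrow> gabor_generic \<phi>" for \<phi> :: "'n::finite cvec"
proof -
  have supp: "CARD('n)\<^sup>2 - CARD('n) + 1 \<le> card (stft_supp \<phi> f) \<longleftrightarrow>
      (\<forall>\<Lambda>. card \<Lambda> = CARD('n) \<longrightarrow> \<not> (\<forall>p\<in>\<Lambda>. stft \<phi> f $ p = 0))" (is "?L \<longleftrightarrow> ?R") for f
  proof -
    define Z where "Z = {p. stft \<phi> f $ p = 0}"
    have "stft_supp \<phi> f = UNIV - Z" by (auto simp: stft_supp_def Z_def)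
    then have "card (stft_supp \<phi> f) = CARD('n)\<^sup>2 - card Z"
      by (simp add: card_Diff_subset power2_eq_square)
    moreover have "card Z \<le> CARD('n tf)" by (intro card_mono) auto
    then have "card Z \<le> CARD('n)\<^sup>2" by (simp add: power2_eq_square)
    moreover have "CARD('n) \<le> CARD('n)\<^sup>2" by (simp add: power2_eq_square)
    ultimately have "?L \<longleftrightarrow> card Z < CARD('n)" by linarith
    also have "\<dots> \<longleftrightarrow> ?R"
    proof -
      have "(\<exists>\<Lambda>\<subseteq>Z. card \<Lambda> = CARD('n)) \<longleftrightarrow> CARD('n) \<le> card Z"
        by (metis card_mono finite obtain_subset_with_card_n)
      moreover have "\<Lambda> \<subseteq> Z \<longleftrightarrow> (\<forall>p\<in>\<Lambda>. stft \<phi> f $ p = 0)" for \<Lambda>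
        by (auto simp: Z_def)
      ultimately show ?thesis by (metis not_le)
    qed
    finally show ?thesis .
  qed
  show ?thesis
    unfolding large_stft_supp_def gabor_generic_iff_stft supp by blast
qed

lemma determined_by_samples_iff: "determined_by_samples \<phi> \<longleftrightarrow> gabor_generic \<phi>" for \<phi> :: "'n::finite cvec"
proof
  assume D: "determined_by_samples \<phi>"
  show "gabor_generic \<phi>"
    unfolding gabor_generic_iff_stft
  proof (intro allI impI, rule ccontr)
    fix \<Lambda> :: "'n tf set" and f
    assume *: "card \<Lambda> = CARD('n)" "\<forall>p\<in>\<Lambda>. stft \<phi> f $ p = 0" "f \<noteq> 0"
    have "stft \<phi> 0 $ p = 0" for p by (simp add: stft_nth hinner_def)
    \<comment> \<open>Compare the nonzero signal \<open>f\<close> with \<open>g = 0\<close>.\<close>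
    then have "0 = f" using D * unfolding determined_by_samples_def by metis
    with * show False by simp
  qed
next
  assume G: "gabor_generic \<phi>"
  show "determined_by_samples \<phi>"
    unfolding determined_by_samples_def
  proof (intro allI impI)
    fix f g and \<Lambda> :: "'n tf set"
    assume card: "card \<Lambda> = CARD('n)" and "\<forall>p\<in>\<Lambda>. stft \<phi> g $ p = stft \<phi> f $ p"
    then have "\<forall>p\<in>\<Lambda>. stft \<phi> (g - f) $ p = 0" by (simp add: stft_diff)
    then have "g - f = 0"
      using G card unfolding gabor_generic_iff_stft by blast
    then show "stft \<phi> g = stft \<phi> f \<and> g = f" by simp
  qed
qed

section \<open>Tightness and robustness\<close>

lemma norm_vec_power2: "(norm f)\<^sup>2 = (\<Sum>i\<in>UNIV. (cmod (f $ i))\<^sup>2)" for f :: "complex ^ 'd::finite"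
  by (simp add: norm_vec_def L2_set_def sum_nonneg)

lemma sum_diff_reindex: "(\<Sum>j\<in>UNIV. F (k - j)) = (\<Sum>j\<in>UNIV. F j)" for k :: "'n::finite mod_ring"
  by (rule sum.reindex_bij_witness[of _ "\<lambda>j. k - j" "\<lambda>j. k - j"]) auto

lemma sum_shift_reindex: "(\<Sum>j\<in>UNIV. F (j - k)) = (\<Sum>j\<in>UNIV. F j)" for k :: "'n::finite mod_ring"
  by (rule sum.reindex_bij_witness[of _ "\<lambda>j. j + k" "\<lambda>j. j - k"]) auto

text \<open>
  Parseval's identity for the discrete Fourier transform, from orthogonality of characters.
\<close>

lemma parseval:
  fixes g :: "'n::finite mod_ring \<Rightarrow> complex"
  shows "(\<Sum>l\<in>(UNIV :: 'n mod_ring set). (cmod (\<Sum>k\<in>UNIV. g k * cnj (node l ^ rep k)))\<^sup>2) =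
    of_nat CARD('n) * (\<Sum>k\<in>UNIV. (cmod (g k))\<^sup>2)"
proof -
  have "complex_of_real (\<Sum>l\<in>(UNIV :: 'n mod_ring set). (cmod (\<Sum>k\<in>UNIV. g k * cnj (node l ^ rep k)))\<^sup>2)
      = (\<Sum>l\<in>(UNIV :: 'n mod_ring set). \<Sum>j\<in>UNIV. \<Sum>k\<in>UNIV. (g j * cnj (node l ^ rep j)) * cnj (g k * cnj (node l ^ rep k)))"
    unfolding of_real_sum complex_norm_square cnj_sum sum_product ..
  also have "\<dots> = (\<Sum>j\<in>UNIV. \<Sum>k\<in>UNIV. \<Sum>l\<in>(UNIV :: 'n mod_ring set). (g j * cnj (node l ^ rep j)) * cnj (g k * cnj (node l ^ rep k)))"
    by (subst sum.swap, rule sum.cong[OF refl], rule sum.swap)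
  also have "\<dots> = (\<Sum>j\<in>UNIV. \<Sum>k\<in>UNIV. g j * cnj (g k) * (if k = j then of_nat CARD('n) else 0))"
    unfolding node_orthogonality[symmetric] sum_distrib_left by (simp add: mult_ac)
  also have "\<dots> = (\<Sum>j\<in>UNIV. \<Sum>k\<in>UNIV. if k = j then g j * cnj (g j) * of_nat CARD('n) else 0)"
    by (intro sum.cong) auto
  also have "\<dots> = of_nat CARD('n) * (\<Sum>j\<in>UNIV. g j * cnj (g j))"
    by (simp add: sum_distrib_left mult_ac)
  also have "\<dots> = complex_of_real (of_nat CARD('n) * (\<Sum>k\<in>UNIV. (cmod (g k))\<^sup>2))"
    by (simp add: complex_norm_square[symmetric])
  finally show ?thesis by (simp only: of_real_eq_iff)
qed

text \<open>
  For a fixed time shift \<open>\<kappa>\<close>, the sum over all modulations is the energy of the Fourier transform of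
  the product of \<open>f\<close> with the conjugate of the shifted window. Summing over \<open>\<kappa>\<close> as well moves every entry
  of \<open>\<phi>\<close> over every entry of \<open>f\<close>.
\<close>

lemma gabor_energy:
  fixes \<phi> :: "'n::finite cvec"
  shows "(\<Sum>p\<in>UNIV. (cmod (hinner f (gabor \<phi> p)))\<^sup>2) = (of_nat CARD('n) * (norm \<phi>)\<^sup>2) * (norm f)\<^sup>2"
proof -
  have "(\<Sum>p\<in>UNIV. (cmod (hinner f (gabor \<phi> p)))\<^sup>2) =
      (\<Sum>\<kappa>\<in>UNIV. \<Sum>l\<in>(UNIV :: 'n mod_ring set). (cmod (\<Sum>k\<in>UNIV. (f $ k * cnj (\<phi> $ (k - \<kappa>))) * cnj (node l ^ rep k)))\<^sup>2)"
    by (simp add: sum.cartesian_product hinner_def gabor_nth mult_ac case_prod_beta)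
  also have "\<dots> = of_nat CARD('n) * (\<Sum>\<kappa>\<in>UNIV. \<Sum>k\<in>UNIV. (cmod (f $ k))\<^sup>2 * (cmod (\<phi> $ (k - \<kappa>)))\<^sup>2)"
    by (simp only: parseval sum_distrib_left[symmetric] norm_mult complex_mod_cnj power_mult_distrib)
  also have "(\<Sum>\<kappa>\<in>UNIV. \<Sum>k\<in>UNIV. (cmod (f $ k))\<^sup>2 * (cmod (\<phi> $ (k - \<kappa>)))\<^sup>2) = (\<Sum>k\<in>UNIV. (cmod (f $ k))\<^sup>2 * (norm \<phi>)\<^sup>2)"
    unfolding norm_vec_power2
    by (subst sum.swap) (simp only: sum_distrib_left[symmetric] sum_diff_reindex[where F = "\<lambda>i. (cmod (\<phi> $ i))\<^sup>2"])
  also have "\<dots> = (norm \<phi>)\<^sup>2 * (norm f)\<^sup>2"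
    unfolding norm_vec_power2[of f] sum_distrib_right[symmetric] by (rule mult.commute)
  finally show ?thesis by (simp only: mult.assoc)
qed

lemma norm_gabor: "norm (gabor \<phi> p) = norm \<phi>"
proof -
  have "(norm (gabor \<phi> p))\<^sup>2 = (norm \<phi>)\<^sup>2"
    unfolding norm_vec_power2
    by (simp add: gabor_nth norm_mult norm_power sum_shift_reindex[where F = "\<lambda>i. (cmod (\<phi> $ i))\<^sup>2"])
  then show ?thesis by simp
qed

lemma equal_norm_tight_frame_gabor:
  fixes \<phi> :: "'n::finite cvec"
  assumes "\<phi> \<noteq> 0"
  shows "equal_norm_tight_frame (gabor \<phi>) UNIV"
proof -
  let ?c = "of_nat CARD('n) * (norm \<phi>)\<^sup>2 :: real"
  have bounds: "frame_bounds (gabor \<phi>) UNIV ?c ?c"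
    by (simp only: frame_bounds_def gabor_energy order_refl simp_thms)
  have pos: "0 < ?c" "0 < norm \<phi>" using assms by simp_all
  have "is_frame (gabor \<phi>) UNIV"
    unfolding is_frame_def using bounds pos(1) by (intro conjI finite exI[of _ ?c]) simp_all
  then have "tight_frame (gabor \<phi>) UNIV"
    unfolding tight_frame_def using bounds pos(1) by (intro conjI exI[of _ ?c])
  then show ?thesis
    unfolding equal_norm_tight_frame_def using pos(2)
    by (intro conjI exI[of _ "norm \<phi>"]) (simp_all add: norm_gabor)
qed

lemma lin_indep_if_gabor_generic:
  fixes \<phi> :: "'n::finite cvec"
  assumes "gabor_generic \<phi>" and "card J \<le> CARD('n)"
  shows "lin_indep_family (gabor \<phi>) J"
proof -
  have "CARD('n) \<le> CARD('n tf)" by simp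
  then obtain \<Lambda> where "J \<subseteq> \<Lambda>" "card \<Lambda> = CARD('n)"
    using exists_subset_between[OF assms(2) _ subset_UNIV] by auto
  then show ?thesis
    using assms(1) lin_indep_family_subset unfolding gabor_generic_iff_lin_indep by blast
qed

lemma window_nonzero_if_gabor_generic:
  fixes \<phi> :: "'n::finite cvec"
  assumes "gabor_generic \<phi>"
  shows "\<phi> \<noteq> 0"
proof
  assume "\<phi> = 0"
  then have "stft \<phi> (\<chi> i. 1) $ p = 0" for p
    by (simp add: stft_nth hinner_def gabor_nth)
  moreover have "card (range (\<lambda>j :: 'n mod_ring. (j, 0 :: 'n mod_ring))) = CARD('n)"
    by (simp add: card_image inj_on_def)
  ultimately have "(\<chi> i. 1) = (0 :: 'n cvec)"
    using assms unfolding gabor_generic_iff_stft by blast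
  then show False by (simp add: vec_eq_iff)
qed

text \<open>
  Tightness and equal norms come for free once \<open>\<phi> \<noteq> 0\<close>, which genericity implies.
\<close>

lemma full_gabor_robust_entf_iff: "full_gabor_robust_entf \<phi> \<longleftrightarrow> gabor_generic \<phi>"
proof
  assume "full_gabor_robust_entf \<phi>"
  then show "gabor_generic \<phi>"
    by (simp add: full_gabor_robust_entf_def maximally_robust_def gabor_generic_iff_lin_indep)
next
  assume G: "gabor_generic \<phi>"
  then show "full_gabor_robust_entf \<phi>"
    unfolding full_gabor_robust_entf_def maximally_robust_def
    using equal_norm_tight_frame_gabor[OF window_nonzero_if_gabor_generic[OF G]] lin_indep_if_gabor_generic[OF G]
    by simp
qed

section \<open>Identifiability\<close>

text \<open>
  Applied to a unit vector at \<open>j - \<kappa>\<close> and read off at coordinate \<open>j\<close>, a linear relation retains only the terms with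
  time shift \<open>\<kappa>\<close>. Letting \<open>j\<close> vary gives a Vandermonde system for their coefficients.
\<close>

lemma tf_shifts_linearly_independent:
  fixes \<Lambda> :: "'n::finite tf set"
  assumes zero: "\<And>x. (\<Sum>p\<in>\<Lambda>. a p *s tf_shift p x) = 0" and "q \<in> \<Lambda>"
  shows "a q = 0"
proof -
  define B where "B = {p \<in> \<Lambda>. fst p = fst q}"
  have inj: "inj_on (\<lambda>p. node (snd p)) B"
  proof (rule inj_onI)
    fix p p' assume "p \<in> B" "p' \<in> B" "node (snd p) = node (snd p')"
    then show "p = p'" by (intro prod_eqI) (simp_all add: B_def inj_eq[OF inj_node])
  qed
  have "inj_on snd B" by (auto simp: inj_on_def B_def)
  then have "card B \<le> card (UNIV :: 'n mod_ring set)"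
    by (rule card_inj_on_le) auto
  then have card: "card B \<le> CARD('n)" by simp
  show "a q = 0"
  proof (rule generalized_vandermonde_injective[where S = 0, OF _ inj])
    fix m assume "m < 0 + card B"
    then have m: "rep (res m :: 'n mod_ring) = m" using card by (intro rep_res) simp
    define j :: "'n mod_ring" where "j = res m"
    have "a p * (node (snd p) ^ rep j * axis (j - fst q) 1 $ (j - fst p)) = (if p \<in> B then a p * node (snd p) ^ m else 0)" if "p \<in> \<Lambda>" for p
      using that m by (auto simp: B_def axis_def j_def)
    then have "(\<Sum>p\<in>\<Lambda>. a p * (node (snd p) ^ rep j * axis (j - fst q) 1 $ (j - fst p))) = (\<Sum>p\<in>B. a p * node (snd p) ^ m)"
      by (simp add: B_def sum.inter_filter cong: conj_cong)
    moreover have "(\<Sum>p\<in>\<Lambda>. a p *s gabor (axis (j - fst q) 1) p) $ j = 0"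
      unfolding gabor_def zero by simp
    ultimately show "(\<Sum>p\<in>B. a p * node (snd p) ^ m) = 0"
      by (simp add: gabor_nth)
  qed (use assms(2) in \<open>auto simp: B_def\<close>)
qed

text \<open>
  Identifiability concerns operators, linear independence concerns coefficients; the two match
  because an operator in the span determines its coefficients.
\<close>

lemma identifiable_operator_span_iff: "identifiable (operator_span \<Lambda>) \<phi> \<longleftrightarrow> lin_indep_family (gabor \<phi>) \<Lambda>"
proof
  assume inj: "identifiable (operator_span \<Lambda>) \<phi>"
  show "lin_indep_family (gabor \<phi>) \<Lambda>"
    unfolding lin_indep_family_iff[OF finite]
  proof (intro allI impI ballI)
    fix a q assume a: "(\<Sum>p\<in>\<Lambda>. a p *s gabor \<phi> p) = 0" and q: "q \<in> \<Lambda>"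
    let ?H = "\<lambda>b x. \<Sum>p\<in>\<Lambda>. b p *s tf_shift p x"
    have mem: "?H b \<in> operator_span \<Lambda>" for b unfolding operator_span_def by blast
    have eq: "?H a \<phi> = ?H (\<lambda>_. 0) \<phi>" using a by (simp add: gabor_def)
    have "?H a = ?H (\<lambda>_. 0)"
      by (rule inj_onD[OF inj[unfolded identifiable_def] _ mem mem]) (rule eq)
    then have "?H a x = 0" for x by (simp add: fun_eq_iff)
    then show "a q = 0" using q by (rule tf_shifts_linearly_independent)
  qed
next
  assume indep: "lin_indep_family (gabor \<phi>) \<Lambda>"
  show "identifiable (operator_span \<Lambda>) \<phi>"
    unfolding identifiable_def
  proof (rule inj_onI)
    fix H H' assume "H \<in> operator_span \<Lambda>" "H' \<in> operator_span \<Lambda>" and eq: "H \<phi> = H' \<phi>"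
    then obtain a b where H: "H = (\<lambda>x. \<Sum>p\<in>\<Lambda>. a p *s tf_shift p x)" "H' = (\<lambda>x. \<Sum>p\<in>\<Lambda>. b p *s tf_shift p x)"
      unfolding operator_span_def by blast
    have zero: "(\<Sum>p\<in>\<Lambda>. (a p - b p) *s gabor \<phi> p) = 0"
      using eq by (simp add: H gabor_def sum_subtractf)
    have indep': "(\<Sum>p\<in>\<Lambda>. c p *s gabor \<phi> p) = 0 \<Longrightarrow> p \<in> \<Lambda> \<Longrightarrow> c p = 0" for c p
      using indep unfolding lin_indep_family_iff[OF finite] by blast
    have "a p - b p = 0" if "p \<in> \<Lambda>" for p
      by (rule indep'[where c = "\<lambda>p. a p - b p", OF zero that])
    then have "a p *s tf_shift p x = b p *s tf_shift p x" if "p \<in> \<Lambda>" for p x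
      using that by simp
    then show "H = H'" unfolding H by (intro ext sum.cong) simp_all
  qed
qed

lemma card_le_if_lin_indep:
  fixes v :: "'k \<Rightarrow> complex ^ 'd::finite"
  assumes "lin_indep_family v K"
  shows "card K \<le> CARD('d)"
proof -
  have "card (v ` K) \<le> vec.dim (UNIV :: (complex ^ 'd) set)"
    using assms by (intro vec.independent_card_le_dim) (auto simp: lin_indep_family_def)
  then show ?thesis
    using assms unfolding vec_dim_card by (simp add: lin_indep_family_def card_image)
qed

lemma identifiability_criterion_iff: "identifiability_criterion \<phi> \<longleftrightarrow> gabor_generic \<phi>"
proof
  assume "identifiability_criterion \<phi>"
  then show "gabor_generic \<phi>"
    unfolding identifiability_criterion_def identifiable_operator_span_iff gabor_generic_iff_lin_indep by simp
next
  assume G: "gabor_generic \<phi>"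
  show "identifiability_criterion \<phi>"
    unfolding identifiability_criterion_def identifiable_operator_span_iff
    using lin_indep_if_gabor_generic[OF G] card_le_if_lin_indep[of "gabor \<phi>"] by auto
qed

section \<open>Almost every window is generic\<close>

lemma AE_gabor_generic: "AE \<phi> :: 'n::finite cvec in lebesgue. gabor_generic \<phi>"
proof -
  have "AE \<phi> :: 'n cvec in lborel. \<forall>e\<in>{e. inj e}. det (gabor_matrix \<phi> e) \<noteq> 0"
    by (rule AE_finite_allI) (auto intro: AE_det_gabor_matrix_nonzero)
  then show ?thesis
    by (intro AE_completion) (simp add: gabor_generic_def)
qed

theorem theorem1p6:
  shows "(\<forall>\<phi> :: 'n::finite cvec.
            (all_minors_nonzero \<phi> \<longleftrightarrow> full_gabor_glp \<phi>) \<and>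
            (full_gabor_glp \<phi> \<longleftrightarrow> full_gabor_robust_entf \<phi>) \<and>
            (full_gabor_robust_entf \<phi> \<longleftrightarrow> large_stft_supp \<phi>) \<and>
            (large_stft_supp \<phi> \<longleftrightarrow> determined_by_samples \<phi>) \<and>
            (determined_by_samples \<phi> \<longleftrightarrow> identifiability_criterion \<phi>)) \<and>
         (AE \<phi> :: 'n cvec in lebesgue.
            all_minors_nonzero \<phi> \<and> full_gabor_glp \<phi> \<and> full_gabor_robust_entf \<phi> \<and>
            large_stft_supp \<phi> \<and> determined_by_samples \<phi> \<and> identifiability_criterion \<phi>)"
  unfolding all_minors_nonzero_iff full_gabor_glp_iff full_gabor_robust_entf_iff
    large_stft_supp_iff determined_by_samples_iff identifiability_criterion_iff
  using AE_gabor_generic by simp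

end
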